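(* Let $\sigma_w=\{v\in\mathbb{F}_2^n:\mathrm{wt}(v)=w\}$ be the Hamming sphere of radius $w$ in $\mathbb{F}_2^n$, and let $t$ be a positive integer. A set $D\subseteq\sigma_w$ is a $t$-design if and only if $\sum_{v\in D}Q(v)=0$ for all $Q\in\bigcup_{d=1}^t\mathcal{D}_d^0$, where $\mathcal{D}_d^0$ is the space of degree-$d$ discrete harmonic polynomials on $\mathbb{F}_2^n$.
   Context: $\mathrm{wt}(v)$ is the number of nonzero coordinates of $v$. A $t$-$(n,w,\lambda)$-design is a (possibly empty) collection $D$ of distinct $w$-element subsets of $\{1,\dots,n\}$ such that $|\{S'\in D: S\subseteq S'\}|=\lambda$ for every $S\subset\{1,\dots,n\}$ with $|S|=t$; a $t$-design is a $t$-$(n,w,\lambda)$-design for some $\lambda$. Subsets $S'$ of $\{1,\dots,n\}$ of size $w$ are identified with their indicator vectors in $\sigma_w$, so a subset of $\sigma_w$ can be a $t$-design. Discrete harmonic polynomials: functions $\mathbb{F}_2^n\to\mathbb{C}$ are identified with elements of $(\mathbb{C}^2)^{\otimes n}$, the pure tensor $\binom{g_{10}}{g_{11}}\otimes\cdots\otimes\binom{g_{n0}}{g_{n1}}$ being the function $v\mapsto g_{1v_1}\cdots g_{nv_n}$. Let $\mathcal{D}_d$ be the complex span of the functions $v\mapsto\prod_{j\in J}(-1)^{v_j}$ with $J\subseteq\{1,\dots,n\}$, $|J|=d$ (with $\mathcal{D}_d=\{0\}$ for $d<0$). Let $X'=\tfrac12\begin{pmatrix}1&-1\\1&-1\end{pmatrix}$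 and $\tilde X'=\sum_{j=1}^n I\otimes\cdots\otimes X'\otimes\cdots\otimes I$ ($X'$ in the $j$-th factor, the $2\times2$ identity matrix $I$ in the others). Then $\tilde X'$ maps $\mathcal{D}_d$ to $\mathcal{D}_{d-1}$, and $\mathcal{D}_d^0:=\ker(\tilde X':\mathcal{D}_d\to\mathcal{D}_{d-1})$ is the space of degree-$d$ discrete harmonic polynomials.
   Formalization: It is additionally assumed that t ≤ w, or w = 0, or w ≥ n (and n ≥ 1): if 0 < w < n and w < t, every D ⊆ σ_w is vacuously a t-design with λ = 0, but a single point D = {v} with v_i = 1, v_j = 0 has nonzero sum for the harmonic Q = (-1)^{v_i} − (-1)^{v_j}. *)

theory Defs
  imports "HOL-Analysis.Analysis" "HOL-Library.Z2"
begin

instance bit :: finite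
proof
  have "(UNIV :: bit set) = {0, 1}"
    by (auto intro: bit_not_zero_iff[THEN iffD1])
  then show "finite (UNIV :: bit set)"
    by (metis finite.emptyI finite.insertI)
qed

section \<open>Hamming spheres and designs\<close>

text \<open>The space \<open>F_2^n\<close> is \<^typ>\<open>bit ^ 'n\<close>, with \<open>n = CARD('n)\<close>; the type \<^typ>\<open>'n\<close> plays the
  role of \<open>{1, ..., n}\<close>.\<close>

definition supp :: "bit ^ 'n \<Rightarrow> 'n set" where
  "supp v = {j. v $ j \<noteq> 0}"

definition wt :: "bit ^ 'n \<Rightarrow> nat" where
  "wt v = card (supp v)"

definition sphere_F2 :: "nat \<Rightarrow> (bit ^ 'n) set" where
  "sphere_F2 w = {v. wt v = w}"

definition is_design :: "nat \<Rightarrow> nat \<Rightarrow> nat \<Rightarrow> 'n::finite set set \<Rightarrow> bool" where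
  "is_design t w l B \<longleftrightarrow>
     B \<subseteq> {S'. card S' = w} \<and> (\<forall>S. card S = t \<longrightarrow> card {S' \<in> B. S \<subseteq> S'} = l)"

text \<open>A set of vectors is regarded as a family of blocks through \<^const>\<open>supp\<close>, the inverse of
  the map sending a subset to its indicator vector.\<close>

definition is_t_design :: "nat \<Rightarrow> nat \<Rightarrow> (bit ^ 'n::finite) set \<Rightarrow> bool" where
  "is_t_design t w D \<longleftrightarrow> (\<exists>l. is_design t w l (supp ` D))"

section \<open>Discrete harmonic polynomials\<close>

text \<open>A function \<open>F_2^n \<rightarrow> C\<close> is an element of \<^typ>\<open>complex ^ (bit ^ 'n)\<close>, its value at
  \<open>v\<close> being the coordinate with index \<open>v\<close>.  In these coordinates a tensor product of
  \<open>2 \<times> 2\<close> matrices is a matrix indexed by \<open>F_2^n\<close>; lemma \<open>tensor_mat_pure_tensor\<close> below states its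
  action on pure tensors.\<close>

definition pure_tensor :: "('n \<Rightarrow> complex ^ bit) \<Rightarrow> complex ^ (bit ^ 'n::finite)" where
  "pure_tensor g = (\<chi> v. \<Prod>j\<in>UNIV. g j $ (v $ j))"

definition tensor_mat ::
    "('n \<Rightarrow> complex ^ bit ^ bit) \<Rightarrow> complex ^ (bit ^ 'n::finite) ^ (bit ^ 'n)" where
  "tensor_mat A = (\<chi> v u. \<Prod>j\<in>UNIV. A j $ (v $ j) $ (u $ j))"

lemma tensor_mat_pure_tensor:
  fixes A :: "'n::finite \<Rightarrow> complex ^ bit ^ bit"
  shows "tensor_mat A *v pure_tensor g = pure_tensor (\<lambda>j. A j *v g j)"
proof -
  have bij: "bij_betw vec_lambda (Pi\<^sub>E UNIV (\<lambda>_. UNIV)) (UNIV :: (bit ^ 'n) set)"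
    by (rule bij_betwI[where g = vec_nth]) auto
  have "(\<Sum>u\<in>(UNIV :: (bit ^ 'n) set). \<Prod>j\<in>UNIV. A j $ (v $ j) $ (u $ j) * g j $ (u $ j))
      = (\<Prod>j\<in>UNIV. \<Sum>b\<in>UNIV. A j $ (v $ j) $ b * g j $ b)" for v :: "bit ^ 'n"
    by (subst sum.reindex_bij_betw[OF bij, symmetric], subst prod_sum_PiE) auto
  then show ?thesis
    by (simp add: vec_eq_iff tensor_mat_def pure_tensor_def matrix_vector_mult_def
        prod.distrib)
qed

definition char_fun :: "'n::finite set \<Rightarrow> complex ^ (bit ^ 'n)" where
  "char_fun J = (\<chi> v. \<Prod>j\<in>J. if v $ j = 0 then 1 else - 1)"

definition DP :: "nat \<Rightarrow> (complex ^ (bit ^ 'n::finite)) set" where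
  "DP d = vec.span {char_fun J | J. card J = d}"

definition X' :: "complex ^ bit ^ bit" where
  "X' = (\<chi> a b. if b = 0 then 1 / 2 else - 1 / 2)"

definition X'_tilde :: "complex ^ (bit ^ 'n::finite) ^ (bit ^ 'n)" where
  "X'_tilde = (\<Sum>j\<in>UNIV. tensor_mat ((\<lambda>_. mat 1)(j := X')))"

text \<open>In particular \<open>X'_tilde\<close> maps \<open>DP d\<close> to \<open>DP (d - 1)\<close> for \<open>d > 0\<close>, and it maps \<open>DP 0\<close> to
  \<open>{0}\<close>, the space of degree \<open>-1\<close>; hence a natural number suffices as degree.\<close>

lemma X'_tilde_char_fun: "X'_tilde *v char_fun J = (\<Sum>j\<in>J. char_fun (J - {j}))"
proof -
  define g :: "'a set \<Rightarrow> 'a \<Rightarrow> complex ^ bit"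
    where "g K j = (\<chi> b. if j \<in> K \<and> b \<noteq> 0 then - 1 else 1)" for K j
  have UNIV_bit: "(UNIV :: bit set) = {0, 1}"
    by (auto intro: bit_not_zero_iff[THEN iffD1])
  have g: "char_fun K = pure_tensor (g K)" for K
  proof -
    have "(\<Prod>j\<in>K. if v $ j = 0 then 1 else - 1) = (\<Prod>j\<in>UNIV. g K j $ (v $ j))" for v :: "bit ^ 'a"
      by (rule prod.mono_neutral_cong_left) (auto simp: g_def)
    then show ?thesis
      by (simp add: char_fun_def pure_tensor_def)
  qed
  have X: "X' *v g J j = (if j \<in> J then g (J - {j}) j else 0)" for j
    by (simp add: vec_eq_iff X'_def g_def matrix_vector_mult_def UNIV_bit)
  have "tensor_mat ((\<lambda>_. mat 1)(j := X')) *v char_fun J = (if j \<in> J then char_fun (J - {j}) else 0)" for j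
  proof (cases "j \<in> J")
    case True
    have "((\<lambda>_. mat 1)(j := X')) i *v g J i = g (J - {j}) i" for i
      using True X[of j] by (cases "i = j") (simp_all add: g_def[of _ i])
    then have "(\<lambda>i. ((\<lambda>_. mat 1)(j := X')) i *v g J i) = g (J - {j})" ..
    with True show ?thesis
      by (simp add: g tensor_mat_pure_tensor)
  next
    case False
    have "(\<Prod>i\<in>UNIV. (((\<lambda>_. mat 1)(j := X')) i *v g J i) $ (v $ i)) = 0" for v :: "bit ^ 'a"
      using False X by (intro prod_zero) (auto intro!: bexI[of _ j])
    with False show ?thesis
      by (simp add: g tensor_mat_pure_tensor) (simp add: pure_tensor_def vec_eq_iff)
  qed
  moreover have "(\<Sum>j\<in>S. M j) *v x = (\<Sum>j\<in>S. M j *v x)"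
    for S :: "'a set" and M :: "'a \<Rightarrow> complex ^ (bit ^ 'a) ^ (bit ^ 'a)" and x
    by (induction S rule: infinite_finite_induct) (auto simp: matrix_vector_mult_add_rdistrib)
  ultimately show ?thesis
    by (simp add: X'_tilde_def sum.If_cases)
qed

definition harmonic :: "nat \<Rightarrow> (complex ^ (bit ^ 'n::finite)) set" where
  "harmonic d = {Q \<in> DP d. X'_tilde *v Q = 0}"

end

theory Submission
  imports Defs
begin

text \<open>Both conditions say that for every \<open>d \<le> t\<close> the functional \<open>L q = (\<Sum>v\<in>D. q v)\<close> is a multiple
  of the evaluation \<open>q \<mapsto> q 0\<close> on \<open>DP d\<close>, that is, takes the same value on all characters of degree
  \<open>d\<close>; a harmonic polynomial of positive degree vanishes at \<open>0\<close>.  For designs this is the expansion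
  of characters into the monomials \<open>v \<mapsto> [S \<subseteq> supp v]\<close> and conversely.  For harmonic sums, let \<open>s\<close>
  be the sum of all degree-one characters, which is the constant \<open>n - 2 w\<close> on the sphere.
  Multiplication by \<open>s\<close> is the sum of \<open>X'_tilde\<close> and its adjoint \<open>U\<close>, and \<open>U\<close> raises the degree, so
  \<open>DP (d + 1) = harmonic (d + 1) + U (DP d)\<close>.  As \<open>U p = (n - 2 w) p - X'_tilde p\<close> on the sphere, the
  values of \<open>L\<close> on \<open>DP (d + 1)\<close> are determined by those in lower degrees.\<close>

section \<open>Characters, monomials and the expansions between them\<close>

lemma nth_eq_0_iff_notin_supp: "v $ j = 0 \<longleftrightarrow> j \<notin> supp v"
  by (simp add: supp_def)

lemma supp_zero [simp]: "supp 0 = {}"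
  by (simp add: supp_def)

lemma inj_supp: "inj supp"
proof (rule injI)
  fix u v :: "bit ^ 'n" assume "supp u = supp v"
  then have "u $ j = 0 \<longleftrightarrow> v $ j = 0" for j
    by (auto simp: nth_eq_0_iff_notin_supp)
  then show "u = v"
    by (metis bit_not_zero_iff vec_eq_iff)
qed

lemma char_fun_nth: "char_fun J $ v = (\<Prod>j\<in>J. if j \<in> supp v then - 1 else 1)"
  unfolding char_fun_def vec_lambda_beta by (rule prod.cong) (auto simp: nth_eq_0_iff_notin_supp)

lemma char_fun_zero [simp]: "char_fun J $ 0 = 1"
  by (simp add: char_fun_nth)

lemma char_fun_empty [simp]: "char_fun {} $ v = 1"
  by (simp add: char_fun_nth)

text \<open>Grouping subsets by size; later this shows that sums over \<open>Pow J\<close> or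
  \<open>Pow S\<close> depend on the set only through its cardinality.\<close>

lemma sum_Pow_card:
  fixes h :: "nat \<Rightarrow> complex"
  assumes "finite A"
  shows "(\<Sum>S\<in>Pow A. h (card S)) = (\<Sum>k\<le>card A. of_nat (card A choose k) * h k)"
proof -
  have "(\<Sum>S\<in>Pow A. h (card S)) = (\<Sum>k\<le>card A. \<Sum>S | S \<in> Pow A \<and> card S = k. h (card S))"
    using assms by (intro sum.group[symmetric]) (auto simp: card_mono)
  also have "\<dots> = (\<Sum>k\<le>card A. of_nat (card A choose k) * h k)"
    using assms by (intro sum.cong) (auto simp: n_subsets)
  finally show ?thesis .
qed

text \<open>Each factor of the character is \<open>1 - 2 * of_bool (j \<in> supp v)\<close>;
  multiply out.\<close>

lemma char_fun_expand:
  "char_fun J $ v = (\<Sum>S\<in>Pow J. (- 2) ^ card S * of_bool (S \<subseteq> supp v))"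
proof -
  have "char_fun J $ v = (\<Prod>j\<in>J. (- 2) * of_bool (j \<in> supp v) + 1)"
    unfolding char_fun_nth by (rule prod.cong) auto
  also have "\<dots> = (\<Sum>S\<in>Pow J. (\<Prod>j\<in>S. (- 2) * of_bool (j \<in> supp v)) * (\<Prod>j\<in>J - S. 1))"
    by (rule prod_add) simp
  also have "\<dots> = (\<Sum>S\<in>Pow J. (- 2) ^ card S * of_bool (S \<subseteq> supp v))"
  proof (rule sum.cong[OF refl])
    fix S assume "S \<in> Pow J"
    have "(\<Prod>j\<in>S. of_bool (j \<in> supp v) :: complex) = of_bool (S \<subseteq> supp v)"
      by (cases "S \<subseteq> supp v") (auto intro!: prod.neutral)
    then show "(\<Prod>j\<in>S. (- 2) * of_bool (j \<in> supp v)) * (\<Prod>j\<in>J - S. 1)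
        = (- 2 :: complex) ^ card S * of_bool (S \<subseteq> supp v)"
      by (simp only: prod.distrib prod_constant power_one mult_1_right)
  qed
  finally show ?thesis .
qed

text \<open>The inverse expansion: with \<open>e\<close> the degree-one character of
  \<open>j\<close>, the indicator of \<open>j \<in> supp v\<close> is
  \<open>(1 - e) / 2\<close>.\<close>

lemma of_bool_subset_expand:
  "of_bool (S \<subseteq> supp v) = (\<Sum>J\<in>Pow S. (- 1) ^ card J / 2 ^ card S * char_fun J $ v)"
proof -
  have "of_bool (S \<subseteq> supp v) = (\<Prod>j\<in>S. of_bool (j \<in> supp v) :: complex)"
    by (cases "S \<subseteq> supp v") (auto intro!: prod.neutral)
  also have "\<dots> = (\<Prod>j\<in>S. (1 / 2) * ((- 1) * (if j \<in> supp v then - 1 else 1) + 1))"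
    by (rule prod.cong) auto
  also have "\<dots> = (1 / 2) ^ card S * (\<Prod>j\<in>S. (- 1) * (if j \<in> supp v then - 1 else 1) + 1)"
    by (simp only: prod.distrib prod_constant)
  also have "(\<Prod>j\<in>S. (- 1 :: complex) * (if j \<in> supp v then - 1 else 1) + 1)
      = (\<Sum>J\<in>Pow S. (\<Prod>j\<in>J. (- 1) * (if j \<in> supp v then - 1 else 1)) * (\<Prod>j\<in>S - J. 1))"
    by (rule prod_add) simp
  also have "\<dots> = (\<Sum>J\<in>Pow S. (- 1) ^ card J * char_fun J $ v)"
    by (simp only: prod.distrib prod_constant char_fun_nth power_one mult_1_right)
  finally show ?thesis
    by (simp add: sum_distrib_left power_divide)
qed

section \<open>The spaces \<open>DP d\<close>, the lowering operator \<open>X'_tilde\<close> and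
  evaluation at \<open>0\<close>\<close>

lemma DP_induct [consumes 1, case_names zero step]:
  assumes "q \<in> DP d"
    and "P 0"
    and "\<And>c J q. card J = d \<Longrightarrow> q \<in> DP d \<Longrightarrow> P q \<Longrightarrow> P (c *s char_fun J + q)"
  shows "P q"
proof -
  have "P q \<and> q \<in> DP d"
    using assms(1) unfolding DP_def
  proof (induction rule: vec.span_induct_alt)
    case base
    then show ?case by (auto simp: assms(2) vec.span_zero)
  next
    case (step c x y)
    then show ?case using assms(3)[of _ y c]
      by (auto simp: DP_def intro!: vec.span_add vec.span_scale intro: vec.span_base)
  qed
  then show ?thesis ..
qed

lemma DP_subspace: "vec.subspace (DP d)"
  unfolding DP_def by (rule vec.subspace_span)

lemma char_fun_in_DP: "card J = d \<Longrightarrow> char_fun J \<in> DP d"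
  unfolding DP_def by (rule vec.span_base) auto

text \<open>The truncated subtraction at \<open>d = 0\<close> is harmless: only
  \<open>J = {}\<close> occurs, and its image is the empty sum.\<close>

lemma X'_tilde_in_DP:
  assumes "q \<in> DP d"
  shows "X'_tilde *v q \<in> DP (d - 1)"
  using assms
proof (induction rule: DP_induct)
  case zero
  then show ?case by (simp add: DP_subspace vec.subspace_0)
next
  case (step c J q)
  then show ?case
    by (auto simp: matrix_vector_right_distrib vec.scale X'_tilde_char_fun
        intro!: vec.subspace_add[OF DP_subspace] vec.subspace_scale[OF DP_subspace]
          vec.subspace_sum[OF DP_subspace] char_fun_in_DP)
qed

text \<open>Every character is \<open>1\<close> at \<open>0\<close>, and \<open>X'_tilde\<close>
  sends one of degree \<open>d\<close> to a sum of \<open>d\<close> characters.\<close>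

lemma X'_tilde_at_zero:
  assumes "q \<in> DP d"
  shows "(X'_tilde *v q) $ 0 = of_nat d * q $ 0"
  using assms
proof (induction rule: DP_induct)
  case (step c J q)
  then show ?case
    by (simp add: matrix_vector_right_distrib vec.scale X'_tilde_char_fun algebra_simps)
qed simp

lemma harmonic_at_zero:
  assumes "h \<in> harmonic d" "d > 0"
  shows "h $ 0 = 0"
  using assms X'_tilde_at_zero[of h d] by (auto simp: harmonic_def)

text \<open>Both sides are linear in \<open>q\<close>, and \<open>k\<close> is the common value on
  characters because these are \<open>1\<close> at \<open>0\<close>.\<close>

lemma DP_eval_sum:
  assumes "\<And>J. card J = d \<Longrightarrow> (\<Sum>v\<in>D. char_fun J $ v) = k" and "q \<in> DP d"
  shows "(\<Sum>v\<in>D. q $ v) = k * q $ 0"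
  using assms(2)
  by (induction rule: DP_induct)
    (simp_all add: assms(1) sum.distrib sum_distrib_left[symmetric] algebra_simps)

section \<open>The degree-one sum and the raising operator\<close>

definition char_sum :: "bit ^ 'n::finite \<Rightarrow> complex" where
  "char_sum v = (\<Sum>j\<in>UNIV. if j \<in> supp v then - 1 else 1)"

text \<open>The operator \<open>U\<close> of the overview. Written as a difference, it gives the
  recursion on the sphere at once; its action on characters and its adjointness to
  \<open>X'_tilde\<close> are then proved.\<close>

definition raise :: "complex ^ (bit ^ 'n::finite) \<Rightarrow> complex ^ (bit ^ 'n)" where
  "raise f = (\<chi> v. char_sum v * f $ v) - X'_tilde *v f"

lemma char_sum_eq: "char_sum (v :: bit ^ 'n::finite) = of_nat CARD('n) - 2 * of_nat (wt v)"
proof -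
  have "char_sum v = (\<Sum>j\<in>UNIV. 1 - 2 * of_bool (j \<in> supp v))"
    unfolding char_sum_def by (rule sum.cong) auto
  then show ?thesis
    by (simp add: sum_subtractf sum_distrib_left[symmetric] wt_def)
qed

lemma raise_nth: "raise f $ v = char_sum v * f $ v - (X'_tilde *v f) $ v"
  by (simp add: raise_def)

lemma raise_add: "raise (f + g) = raise f + raise g"
  by (simp add: vec_eq_iff raise_nth matrix_vector_right_distrib algebra_simps)

lemma raise_scale: "raise (c *s f) = c *s raise f"
  by (simp add: vec_eq_iff raise_nth vec.scale algebra_simps)

text \<open>Degree-one characters square to \<open>1\<close>, so multiplying by the one of
  \<open>j\<close> deletes \<open>j\<close> from \<open>K\<close> or inserts it. The deletions make
  up \<open>X'_tilde\<close>.\<close>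

lemma raise_char_fun: "raise (char_fun K) = (\<Sum>j\<in>- K. char_fun (insert j K))"
proof -
  have "char_sum v * char_fun K $ v
      = (\<Sum>j\<in>K. char_fun (K - {j}) $ v) + (\<Sum>j\<in>- K. char_fun (insert j K) $ v)" for v
  proof -
    let ?e = "\<lambda>j. if j \<in> supp v then - 1 else 1 :: complex"
    have "char_sum v * char_fun K $ v
        = (\<Sum>j\<in>K. ?e j * char_fun K $ v) + (\<Sum>j\<in>- K. ?e j * char_fun K $ v)"
      unfolding char_sum_def sum_distrib_right
      by (subst sum.union_disjoint[symmetric]) (auto simp: Compl_partition)
    moreover have "?e j * char_fun K $ v = char_fun (K - {j}) $ v" if "j \<in> K" for j
      using that by (simp add: char_fun_nth prod.remove[of K j])
    moreover have "?e j * char_fun K $ v = char_fun (insert j K) $ v" if "j \<in> - K" for j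
      using that by (simp add: char_fun_nth)
    ultimately show ?thesis
      by simp
  qed
  then show ?thesis
    by (simp add: vec_eq_iff raise_nth X'_tilde_char_fun)
qed

lemma raise_in_DP:
  assumes "q \<in> DP d"
  shows "raise q \<in> DP (Suc d)"
  using assms
proof (induction rule: DP_induct)
  case zero
  have "raise (0 :: complex ^ (bit ^ 'a)) = 0"
    by (simp add: vec_eq_iff raise_nth)
  then show ?case by (simp add: DP_subspace vec.subspace_0)
next
  case (step c J q)
  then show ?case
    by (auto simp: raise_add raise_scale raise_char_fun
        intro!: vec.subspace_add[OF DP_subspace] vec.subspace_scale[OF DP_subspace]
          vec.subspace_sum[OF DP_subspace] char_fun_in_DP)
qed

text \<open>The \<open>j\<close>-th summand lives on pairs of vectors that agree off
  \<open>j\<close>, where it is an entry of \<open>X'\<close>. Adding the transpose leaves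
  \<open>diag(1, -1)\<close>, the degree-one character of \<open>j\<close>.\<close>

lemma X'_tilde_symmetric_part:
  "X'_tilde $ v $ u + X'_tilde $ u $ v = (if u = v then char_sum v else 0)"
proof -
  have bit_cases: "b = 0 \<or> b = 1" for b :: bit
    using bit_not_zero_iff by blast
  have "tensor_mat ((\<lambda>_. mat 1)(j := X')) $ v $ u + tensor_mat ((\<lambda>_. mat 1)(j := X')) $ u $ v
      = (if u = v then if j \<in> supp v then - 1 else 1 else 0)" for j
  proof -
    have e: "tensor_mat ((\<lambda>_. mat 1)(j := X')) $ x $ y
        = X' $ (x $ j) $ (y $ j) * of_bool (\<forall>i. i \<noteq> j \<longrightarrow> x $ i = y $ i)" for x y :: "bit ^ 'a"
    proof -
      have "tensor_mat ((\<lambda>_. mat 1)(j := X')) $ x $ y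
          = X' $ (x $ j) $ (y $ j) * (\<Prod>i\<in>UNIV - {j}. (mat 1 :: complex ^ bit ^ bit) $ (x $ i) $ (y $ i))"
        by (simp add: tensor_mat_def prod.remove[of UNIV j])
      also have "(\<Prod>i\<in>UNIV - {j}. (mat 1 :: complex ^ bit ^ bit) $ (x $ i) $ (y $ i))
          = of_bool (\<forall>i. i \<noteq> j \<longrightarrow> x $ i = y $ i)"
        by (cases "\<forall>i. i \<noteq> j \<longrightarrow> x $ i = y $ i") (auto simp: mat_def intro!: prod.neutral)
      finally show ?thesis .
    qed
    show ?thesis
    proof (cases "\<forall>i. i \<noteq> j \<longrightarrow> u $ i = v $ i")
      case True
      then have "u = v \<longleftrightarrow> u $ j = v $ j"
        by (metis vec_eq_iff)
      with True show ?thesis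
        using bit_cases[of "u $ j"] bit_cases[of "v $ j"]
        unfolding e by (auto simp: X'_def supp_def)
    next
      case False
      then show ?thesis unfolding e by auto
    qed
  qed
  then show ?thesis
    by (simp add: X'_tilde_def sum.distrib[symmetric] char_sum_def)
qed

text \<open>The adjoint for \<open>inner\<close> is the conjugate transpose; real entries make it
  the plain transpose.\<close>

lemma X'_tilde_real: "X'_tilde $ v $ u \<in> \<real>"
proof -
  have "X' $ a $ b \<in> \<real>" "(mat 1 :: complex ^ bit ^ bit) $ a $ b \<in> \<real>" for a b
    by (auto simp: X'_def mat_def)
  then show ?thesis
    by (auto simp: X'_tilde_def tensor_mat_def intro!: sum_in_Reals prod_in_Reals)
qed

text \<open>\<^const>\<open>raise\<close> is the adjoint of \<open>X'_tilde\<close>, because \<open>X' + X'\<^sup>T = diag(1, -1)\<close>.\<close>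

lemma raise_adjoint: "inner (X'_tilde *v f) g = inner f (raise g)"
proof -
  have inner_real: "inner (a * x) y = Re a * inner x y" "inner x (a * y) = Re a * inner x y"
    if "a \<in> \<real>" for a x y :: complex
    using that by (auto simp: complex_is_Real_iff inner_complex_def algebra_simps)
  let ?a = "\<lambda>v u :: bit ^ 'a. X'_tilde $ v $ u"
  have cs: "char_sum v \<in> \<real>" for v :: "bit ^ 'a"
    by (simp add: char_sum_eq)
  have "inner (X'_tilde *v f) g + inner f (X'_tilde *v g)
     = (\<Sum>v\<in>UNIV. \<Sum>u\<in>UNIV. Re (?a v u) * inner (f $ u) (g $ v))
       + (\<Sum>v\<in>UNIV. \<Sum>u\<in>UNIV. Re (?a v u) * inner (f $ v) (g $ u))"
    by (simp add: inner_vec_def matrix_vector_mult_def inner_sum_left inner_sum_right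
        inner_real X'_tilde_real)
  also have "(\<Sum>v\<in>UNIV. \<Sum>u\<in>UNIV. Re (?a v u) * inner (f $ v) (g $ u))
     = (\<Sum>v\<in>UNIV. \<Sum>u\<in>UNIV. Re (?a u v) * inner (f $ u) (g $ v))"
    by (rule sum.swap)
  also have "(\<Sum>v\<in>UNIV. \<Sum>u\<in>UNIV. Re (?a v u) * inner (f $ u) (g $ v)) + \<dots>
     = (\<Sum>v\<in>UNIV. \<Sum>u\<in>UNIV. Re (?a v u + ?a u v) * inner (f $ u) (g $ v))"
    by (simp add: sum.distrib[symmetric] algebra_simps)
  also have "\<dots> = (\<Sum>v\<in>UNIV. Re (char_sum v) * inner (f $ v) (g $ v))"
    by (simp only: X'_tilde_symmetric_part) (simp add: if_distrib if_distribR sum.delta cong: if_cong)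
  also have "\<dots> = inner f (\<chi> v. char_sum v * g $ v)"
    by (simp add: inner_vec_def inner_real cs)
  finally show ?thesis
    by (simp add: raise_def inner_diff_right algebra_simps)
qed

section \<open>Harmonic decomposition and induction on the degree\<close>

lemma DP_Suc_decomp:
  assumes "q \<in> DP (Suc d)"
  obtains h p where "h \<in> harmonic (Suc d)" "p \<in> DP d" "q = h + raise p"
proof -
  have scaleR: "r *\<^sub>R x = complex_of_real r *s x" for r and x :: "complex ^ (bit ^ 'a)"
    by (simp add: vec_eq_iff complex_eq_iff)
  \<comment> \<open>\<open>inner\<close> is a real inner product, so the orthogonal projection is
    taken onto the image of \<open>raise\<close> as a real subspace.\<close>
  have "subspace (raise ` (DP d :: (complex ^ (bit ^ 'a)) set))"
    unfolding subspace_def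
  proof (intro conjI ballI allI)
    show "0 \<in> raise ` (DP d :: (complex ^ (bit ^ 'a)) set)"
      using vec.subspace_0[OF DP_subspace] by (rule rev_image_eqI) (simp add: vec_eq_iff raise_nth)
  next
    fix x y :: "complex ^ (bit ^ 'a)" assume "x \<in> raise ` DP d" "y \<in> raise ` DP d"
    then show "x + y \<in> raise ` DP d"
      by (auto simp: raise_add[symmetric] intro!: imageI vec.subspace_add[OF DP_subspace])
  next
    fix r and x :: "complex ^ (bit ^ 'a)" assume "x \<in> raise ` DP d"
    then show "r *\<^sub>R x \<in> raise ` DP d"
      by (auto simp: scaleR raise_scale[symmetric] intro!: imageI vec.subspace_scale[OF DP_subspace])
  qed
  then have "span (raise ` (DP d :: (complex ^ (bit ^ 'a)) set)) = raise ` DP d"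
    by (simp add: span_eq_iff)
  then obtain y h where y: "y \<in> raise ` DP d" and h: "\<And>x. x \<in> raise ` DP d \<Longrightarrow> orthogonal h x"
      and q: "q = y + h"
    using orthogonal_subspace_decomp_exists[of "raise ` DP d" q] by metis
  from y obtain p where p: "p \<in> DP d" "y = raise p"
    by blast
  \<comment> \<open>The complement is taken in the whole function space, but \<open>h\<close> stays
    in \<open>DP (Suc d)\<close> since \<open>q\<close> and \<open>raise p\<close> lie
    there.\<close>
  have "h = q - raise p"
    using q p by simp
  then have hDP: "h \<in> DP (Suc d)"
    using assms p raise_in_DP by (auto intro: vec.subspace_diff[OF DP_subspace])
  then have "X'_tilde *v h \<in> DP d"
    using X'_tilde_in_DP by fastforce
  \<comment> \<open>With this test vector, adjointness turns orthogonality into the vanishing of the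
    squared norm of \<open>X'_tilde *v h\<close>.\<close>
  then have "inner h (raise (X'_tilde *v h)) = 0"
    using h by (auto simp: orthogonal_def)
  then have "X'_tilde *v h = 0"
    by (simp add: raise_adjoint[symmetric])
  with hDP have "h \<in> harmonic (Suc d)"
    by (simp add: harmonic_def)
  with p q that show ?thesis
    by (simp add: add.commute)
qed

lemma DP_eval_sum_if_harmonic_sum_zero:
  fixes D :: "(bit ^ 'n::finite) set"
  assumes D: "D \<subseteq> sphere_F2 w"
    and harm: "\<And>d Q. 1 \<le> d \<Longrightarrow> d \<le> t \<Longrightarrow> Q \<in> harmonic d \<Longrightarrow> (\<Sum>v\<in>D. Q $ v) = 0"
  shows "d \<le> t \<Longrightarrow> \<exists>k. \<forall>q \<in> DP d. (\<Sum>v\<in>D. q $ v) = k * q $ 0"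
proof (induction d rule: less_induct)
  case (less d)
  show ?case
  proof (cases d)
    case 0
    have "(\<Sum>v\<in>D. q $ v) = of_nat (card D) * q $ 0" if "q \<in> DP 0" for q
      using _ that by (rule DP_eval_sum) simp
    with 0 show ?thesis by blast
  next
    case (Suc e)
    show ?thesis
    \<comment> \<open>The division by \<open>?m\<close> below needs \<open>e < CARD('n)\<close>;
      otherwise no set has size \<open>Suc e\<close> and \<open>DP d\<close> is zero.\<close>
    proof (cases "CARD('n) \<le> e")
      case True
      have "card J \<noteq> Suc e" for J :: "'n set"
        using True card_mono[of UNIV J] by auto
      then have "DP d = {0 :: complex ^ (bit ^ 'n)}"
        by (simp add: DP_def Suc)
      then show ?thesis by simp
    next
      case False
      \<comment> \<open>\<open>?s\<close> is the value of \<open>char_sum\<close> on the sphere.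
        \<open>?m\<close> is the factor by which \<open>raise\<close> multiplies values at
        \<open>0\<close> on \<open>DP e\<close>: \<open>char_sum 0\<close> minus the
        \<open>e\<close> from \<open>X'_tilde_at_zero\<close>.\<close>
      let ?s = "of_nat CARD('n) - 2 * of_nat w :: complex"
      let ?m = "of_nat CARD('n) - of_nat e :: complex"
      have m: "?m \<noteq> 0"
        using False by simp
      obtain k1 where k1: "\<And>q. q \<in> DP e \<Longrightarrow> (\<Sum>v\<in>D. q $ v) = k1 * q $ 0"
        using less Suc by (metis Suc_leD lessI)
      \<comment> \<open>For \<open>e = 0\<close> this repeats degree \<open>0\<close>, but then
        \<open>k2\<close> only occurs multiplied by \<open>of_nat e = 0\<close>.\<close>
      obtain k2 where k2: "\<And>q. q \<in> DP (e - 1) \<Longrightarrow> (\<Sum>v\<in>D. q $ v) = k2 * q $ 0"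
        using less.IH[of "e - 1"] less.prems Suc by (metis One_nat_def Suc_leD diff_le_self le_imp_less_Suc le_trans)
      have "(\<Sum>v\<in>D. q $ v) = (?s * k1 - k2 * of_nat e) / ?m * q $ 0" if q: "q \<in> DP d" for q
      proof -
        obtain h p where h: "h \<in> harmonic (Suc e)" and p: "p \<in> DP e" and qhp: "q = h + raise p"
          using DP_Suc_decomp q Suc by blast
        have "(\<Sum>v\<in>D. raise p $ v) = (\<Sum>v\<in>D. ?s * p $ v - (X'_tilde *v p) $ v)"
          using D by (intro sum.cong) (auto simp: raise_nth char_sum_eq sphere_F2_def)
        also have "\<dots> = ?s * (k1 * p $ 0) - k2 * (of_nat e * p $ 0)"
          using k1[OF p] k2[OF X'_tilde_in_DP[OF p]] X'_tilde_at_zero[OF p]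
          by (simp add: sum_subtractf sum_distrib_left[symmetric])
        finally have "(\<Sum>v\<in>D. q $ v) = (?s * k1 - k2 * of_nat e) * p $ 0"
          using harm[of "Suc e" h] h less.prems Suc by (simp add: qhp sum.distrib algebra_simps)
        moreover have "q $ 0 = ?m * p $ 0"
          using harmonic_at_zero[OF h] X'_tilde_at_zero[OF p]
          by (simp add: qhp raise_nth char_sum_eq wt_def algebra_simps)
        ultimately show ?thesis
          using m by simp
      qed
      then show ?thesis by blast
    qed
  qed
qed

section \<open>Block counts of designs and character sums\<close>

lemma block_count:
  fixes D :: "(bit ^ 'n::finite) set"
  shows "of_nat (card {S' \<in> supp ` D. S \<subseteq> S'}) = (\<Sum>v\<in>D. of_bool (S \<subseteq> supp v) :: complex)"
proof -
  have "{S' \<in> supp ` D. S \<subseteq> S'} = supp ` {v \<in> D. S \<subseteq> supp v}"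
    by auto
  then have "card {S' \<in> supp ` D. S \<subseteq> S'} = card {v \<in> D. S \<subseteq> supp v}"
    by (simp add: card_image inj_on_subset[OF inj_supp])
  then show ?thesis
    by (simp add: Int_def)
qed

text \<open>Expanding the indicator of \<open>S \<subseteq> supp v\<close> only involves characters
  of subsets of \<open>S\<close>, of degree at most \<open>t\<close>, so the assumption evaluates
  every term by its degree alone.\<close>

lemma design_if_DP_eval_sum:
  fixes D :: "(bit ^ 'n::finite) set"
  assumes D: "D \<subseteq> sphere_F2 w"
    and k: "\<And>d q. d \<le> t \<Longrightarrow> q \<in> DP d \<Longrightarrow> (\<Sum>v\<in>D. q $ v) = k d * q $ 0"
  shows "is_t_design t w D"
proof -
  have *: "of_nat (card {S' \<in> supp ` D. S \<subseteq> S'})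
      = (\<Sum>i\<le>t. of_nat (t choose i) * ((- 1) ^ i / 2 ^ t * k i))" if S: "card S = t" for S :: "'n set"
  proof -
    have "of_nat (card {S' \<in> supp ` D. S \<subseteq> S'})
        = (\<Sum>J\<in>Pow S. (- 1) ^ card J / 2 ^ t * (\<Sum>v\<in>D. char_fun J $ v))"
      unfolding block_count of_bool_subset_expand S sum_distrib_left by (rule sum.swap)
    also have "\<dots> = (\<Sum>J\<in>Pow S. (- 1) ^ card J / 2 ^ t * k (card J))"
    proof (rule sum.cong[OF refl])
      fix J assume "J \<in> Pow S"
      then have "card J \<le> t"
        using S card_mono[of S J] by auto
      then show "(- 1) ^ card J / 2 ^ t * (\<Sum>v\<in>D. char_fun J $ v) = (- 1) ^ card J / 2 ^ t * k (card J)"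
        by (simp add: k char_fun_in_DP)
    qed
    also have "\<dots> = (\<Sum>i\<le>t. of_nat (t choose i) * ((- 1) ^ i / 2 ^ t * k i))"
      using sum_Pow_card[of S "\<lambda>i. (- 1) ^ i / 2 ^ t * k i"] S by simp
    finally show ?thesis .
  qed
  have "card {S' \<in> supp ` D. S \<subseteq> S'} = card {S' \<in> supp ` D. T \<subseteq> S'}"
    if "card S = t" "card T = t" for S T :: "'n set"
    using *[OF that(1)] *[OF that(2)] by (metis of_nat_eq_iff)
  then have "\<exists>l. \<forall>S :: 'n set. card S = t \<longrightarrow> card {S' \<in> supp ` D. S \<subseteq> S'} = l"
    by metis
  moreover have "supp ` D \<subseteq> {S'. card S' = w}"
    using D by (auto simp: sphere_F2_def wt_def)
  ultimately show ?thesis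
    by (auto simp: is_t_design_def is_design_def)
qed

text \<open>Removing \<open>T\<close> gives a bijection onto the subsets of \<open>A - T\<close> of
  size \<open>t - card T\<close>.\<close>

lemma card_between:
  assumes "finite A" "T \<subseteq> A" "card T \<le> t"
  shows "card {S. T \<subseteq> S \<and> S \<subseteq> A \<and> card S = t} = (card A - card T) choose (t - card T)"
proof -
  have fin: "finite T"
    using assms finite_subset by blast
  have "bij_betw (\<lambda>S. S - T) {S. T \<subseteq> S \<and> S \<subseteq> A \<and> card S = t} {B. B \<subseteq> A - T \<and> card B = t - card T}"
  proof (rule bij_betwI[where g = "\<lambda>B. B \<union> T"])
    show "(\<lambda>S. S - T) \<in> {S. T \<subseteq> S \<and> S \<subseteq> A \<and> card S = t} \<rightarrow> {B. B \<subseteq> A - T \<and> card B = t - card T}"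
      using fin by (auto simp: card_Diff_subset)
    have "card (B \<union> T) = t" if "B \<subseteq> A - T" "card B = t - card T" for B
      using that assms fin by (subst card_Un_disjoint) (auto intro: finite_subset)
    then show "(\<lambda>B. B \<union> T) \<in> {B. B \<subseteq> A - T \<and> card B = t - card T} \<rightarrow> {S. T \<subseteq> S \<and> S \<subseteq> A \<and> card S = t}"
      using assms(2) by auto
  qed auto
  then have "card {S. T \<subseteq> S \<and> S \<subseteq> A \<and> card S = t} = card {B. B \<subseteq> A - T \<and> card B = t - card T}"
    by (rule bij_betw_same_card)
  then show ?thesis
    using assms fin by (simp add: n_subsets card_Diff_subset)
qed

text \<open>A \<open>t\<close>-design is also a design for every smaller strength: count the pairs
  of \<open>S\<close> and \<open>v\<close> with \<open>T \<subseteq> S \<subseteq> supp v\<close>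
  and \<open>card S = t\<close> in two ways. The bound \<open>t \<le> w\<close> keeps the divisor
  nonzero.\<close>

lemma block_count_lower:
  fixes D :: "(bit ^ 'n::finite) set" and T :: "'n set"
  assumes D: "D \<subseteq> sphere_F2 w" and "t \<le> w" and T: "card T \<le> t"
    and l: "\<And>S. card S = t \<Longrightarrow> card {S' \<in> supp ` D. S \<subseteq> S'} = l"
  shows "(\<Sum>v\<in>D. of_bool (T \<subseteq> supp v)) =
    (of_nat (((CARD('n) - card T) choose (t - card T)) * l)
      / of_nat ((w - card T) choose (t - card T)) :: complex)"
proof -
  let ?F = "{S. T \<subseteq> S \<and> card S = t}"
  have "(\<Sum>S\<in>?F. of_bool (S \<subseteq> supp v))
      = of_nat ((w - card T) choose (t - card T)) * (of_bool (T \<subseteq> supp v) :: complex)"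
    if v: "v \<in> D" for v
  proof -
    have w: "card (supp v) = w"
      using D v by (auto simp: sphere_F2_def wt_def)
    have "(\<Sum>S\<in>?F. of_bool (S \<subseteq> supp v) :: complex)
        = of_nat (card {S. T \<subseteq> S \<and> S \<subseteq> supp v \<and> card S = t})"
      by (simp add: Int_def conj_ac)
    moreover have "{S. T \<subseteq> S \<and> S \<subseteq> supp v \<and> card S = t} = {}" if "\<not> T \<subseteq> supp v"
      using that by auto
    ultimately show ?thesis
      using card_between[of "supp v" T t] T w by auto
  qed
  then have "of_nat ((w - card T) choose (t - card T)) * (\<Sum>v\<in>D. of_bool (T \<subseteq> supp v) :: complex)
      = (\<Sum>v\<in>D. \<Sum>S\<in>?F. of_bool (S \<subseteq> supp v))"
    by (simp add: sum_distrib_left)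
  also have "\<dots> = (\<Sum>S\<in>?F. of_nat (card {S' \<in> supp ` D. S \<subseteq> S'}))"
    unfolding block_count by (rule sum.swap)
  also have "\<dots> = of_nat (card ?F * l)"
    by (simp add: l)
  also have "card ?F = (CARD('n) - card T) choose (t - card T)"
    using card_between[of UNIV T t] T by simp
  finally show ?thesis
    using \<open>t \<le> w\<close> by (simp add: field_simps)
qed

lemma DP_eval_sum_if_design:
  fixes D :: "(bit ^ 'n::finite) set"
  assumes D: "D \<subseteq> sphere_F2 w" and "t \<le> w" and "is_t_design t w D" and "d \<le> t"
  shows "\<exists>k. \<forall>q \<in> DP d. (\<Sum>v\<in>D. q $ v) = k * q $ 0"
proof -
  obtain l where l: "\<And>S. card S = t \<Longrightarrow> card {S' \<in> supp ` D. S \<subseteq> S'} = l"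
    using assms(3) by (auto simp: is_t_design_def is_design_def)
  \<comment> \<open>By \<open>block_count_lower\<close>, \<open>m i\<close> is the number of blocks
    through any set of \<open>i \<le> t\<close> points.\<close>
  define m :: "nat \<Rightarrow> complex" where
    "m i = of_nat (((CARD('n) - i) choose (t - i)) * l) / of_nat ((w - i) choose (t - i))" for i
  have "(\<Sum>v\<in>D. char_fun J $ v) = (\<Sum>i\<le>d. of_nat (d choose i) * ((- 2) ^ i * m i))"
    if J: "card J = d" for J :: "'n set"
  proof -
    have "(\<Sum>v\<in>D. char_fun J $ v) = (\<Sum>S\<in>Pow J. (- 2) ^ card S * (\<Sum>v\<in>D. of_bool (S \<subseteq> supp v)))"
      unfolding char_fun_expand sum_distrib_left by (rule sum.swap)
    also have "\<dots> = (\<Sum>S\<in>Pow J. (- 2) ^ card S * m (card S))"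
    proof (rule sum.cong[OF refl])
      fix S assume "S \<in> Pow J"
      then have "card S \<le> t"
        using J \<open>d \<le> t\<close> card_mono[of J S] by auto
      then show "(- 2) ^ card S * (\<Sum>v\<in>D. of_bool (S \<subseteq> supp v)) = (- 2) ^ card S * m (card S)"
        using block_count_lower[OF D \<open>t \<le> w\<close> _ l] by (simp add: m_def)
    qed
    also have "\<dots> = (\<Sum>i\<le>d. of_nat (d choose i) * ((- 2) ^ i * m i))"
      using sum_Pow_card[of J "\<lambda>i. (- 2) ^ i * m i"] J by simp
    finally show ?thesis .
  qed
  then show ?thesis
    using DP_eval_sum by blast
qed

text \<open>The sphere contains at most one point, the zero or the all-ones vector, where a
  character depends only on its degree.\<close>

lemma DP_eval_sum_degenerate:
  fixes D :: "(bit ^ 'n::finite) set"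
  assumes D: "D \<subseteq> sphere_F2 w" and "w = 0 \<or> CARD('n) \<le> w"
  shows "\<exists>k. \<forall>q \<in> DP d. (\<Sum>v\<in>D. q $ v) = k * q $ 0"
proof -
  obtain A :: "'n set" where A: "A = {} \<or> A = UNIV" and supp: "\<And>v. v \<in> D \<Longrightarrow> supp v = A"
  proof (cases "w = 0")
    case True
    then have "supp v = {}" if "v \<in> D" for v
      using D that by (auto simp: sphere_F2_def wt_def)
    then show ?thesis using that by blast
  next
    case False
    then have "supp v = UNIV" if "v \<in> D" for v
      using D that assms(2) card_seteq[of UNIV "supp v"] by (auto simp: sphere_F2_def wt_def)
    then show ?thesis using that by blast
  qed
  have "(\<Sum>v\<in>D. char_fun J $ v) = of_nat (card D) * (if A = {} then 1 else (- 1) ^ d)"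
    if "card J = d" for J :: "'n set"
    using A supp that by (auto simp: char_fun_nth)
  then show ?thesis
    using DP_eval_sum by blast
qed

text \<open>If \<open>0 < w < t\<close> and \<open>w < CARD('n)\<close>, every subset of the sphere
  is a design with \<open>l = 0\<close>, as no block has \<open>t\<close> points. Yet a single point
  has a nonzero harmonic sum: take the difference of two degree-one characters with different values
  there. The second assumption excludes exactly this range.\<close>

theorem proposition7p1:
  fixes t w :: nat and D :: "(bit ^ 'n::finite) set"
  assumes "t > 0"
    and "t \<le> w \<or> w = 0 \<or> CARD('n) \<le> w"
    and "D \<subseteq> sphere_F2 w"
  shows "is_t_design t w D \<longleftrightarrow> (\<forall>Q \<in> (\<Union>d\<in>{1..t}. harmonic d). (\<Sum>v\<in>D. Q $ v) = 0)"
proof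
  assume design: "is_t_design t w D"
  show "\<forall>Q \<in> (\<Union>d\<in>{1..t}. harmonic d). (\<Sum>v\<in>D. Q $ v) = 0"
  proof
    fix Q :: "complex ^ (bit ^ 'n)" assume "Q \<in> (\<Union>d\<in>{1..t}. harmonic d)"
    then obtain d where d: "1 \<le> d" "d \<le> t" and Q: "Q \<in> harmonic d"
      by auto
    have "\<exists>k. \<forall>q \<in> DP d. (\<Sum>v\<in>D. q $ v) = k * q $ 0"
      using DP_eval_sum_if_design[OF assms(3) _ design d(2)] DP_eval_sum_degenerate[OF assms(3)]
        assms(2) by blast
    then show "(\<Sum>v\<in>D. Q $ v) = 0"
      using Q harmonic_at_zero[OF Q] d by (auto simp: harmonic_def)
  qed
next
  assume harm: "\<forall>Q \<in> (\<Union>d\<in>{1..t}. harmonic d). (\<Sum>v\<in>D. Q $ v) = 0"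
  have "\<exists>k. \<forall>q \<in> DP d. (\<Sum>v\<in>D. q $ v) = k * q $ 0" if "d \<le> t" for d
    using DP_eval_sum_if_harmonic_sum_zero[OF assms(3) _ that] harm by auto
  then obtain k where "\<And>d q. d \<le> t \<Longrightarrow> q \<in> DP d \<Longrightarrow> (\<Sum>v\<in>D. q $ v) = k d * q $ 0"
    by metis
  then show "is_t_design t w D"
    by (rule design_if_DP_eval_sum[OF assms(3)])
qed

end
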